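(* Let $m,n\ge 2$ be integers and $\mathcal{A}\in\mathbb{R}^{[m,n]}$. The following two statements are equivalent: (a) The tensor $\mathcal{A}$ is R$_0$; (b) There exists $\varepsilon>0$ such that, for any $\delta>0$ and any $a\in\mathbb{R}^n$, the set $$S(\varepsilon,\delta):=\bigcup_{(\mathcal{B},b)\in \mathbb{B}(\mathcal{O},\varepsilon)\times\mathbb{B}(0,\delta)}\mathrm{Sol}(\mathcal{A}+\mathcal{B},a+b)$$ is bounded.
   Context: $\mathbb{R}^{[m,n]}$ is the real vector space (of dimension $n^m$) of real $m$-th order $n$-dimensional tensors $\mathcal{A}=(a_{i_1\cdots i_m})$, $i_j\in[n]=\{1,\dots,n\}$, with the Frobenius norm $\|\mathcal{A}\|=\sqrt{\sum a_{i_1\cdots i_m}^2}$. For $x\in\mathbb{R}^n$, $\mathcal{A}x^{m-1}\in\mathbb{R}^n$ has components $(\mathcal{A}x^{m-1})_i=\sum_{i_2,\dots,i_m=1}^n a_{ii_2\cdots i_m}x_{i_2}\cdots x_{i_m}$, and $\mathcal{A}x^m=\langle x,\mathcal{A}x^{m-1}\rangle$. For $a\in\mathbb{R}^n$, $\mathrm{Sol}(\mathcal{A},a)$ is the solution set of the tensor complementarity problem $\mathrm{TCP}(\mathcal{A},a)$, i.e. the set of $x\in\mathbb{R}^n$ with $x\ge 0$, $\mathcal{A}x^{m-1}+a\ge 0$, $\mathcal{A}x^m+\langle x,a\rangle=0$ (inequalities componentwise). $\mathcal{A}$ is an R$_0$-tensor (is R$_0$) if $\mathrm{Sol}(\mathcal{A},0)=\{0\}$.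 $\mathcal{O}$ is the zero tensor; $\mathbb{B}(\mathcal{O},\varepsilon)$ is the closed ball in $\mathbb{R}^{[m,n]}$ centered at $\mathcal{O}$ with radius $\varepsilon$, and $\mathbb{B}(0,\delta)$ is the closed ball in $\mathbb{R}^n$ centered at $0$ with radius $\delta$. *)

theory Defs
  imports "HOL-Analysis.Analysis"
begin

text \<open>
  A tensor of order \<open>m = CARD('m)\<close> and dimension \<open>n = CARD('n)\<close> is a real vector indexed by the
  multi-indices \<open>'m \<Rightarrow> 'n\<close>, so its library norm is the Frobenius norm. The order on \<open>'m\<close> only
  serves to single out the first position of a multi-index.
\<close>

type_synonym ('m, 'n) tensor = "(real, 'm \<Rightarrow> 'n) vec"

definition first_pos :: "'m::{finite, linorder}" where
  "first_pos = Min UNIV"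

text \<open>
  In the paper's notation, \<open>tensor_apply A x\<close> is \<open>A x\<^sup>m\<^sup>-\<^sup>1\<close> and \<open>tensor_form A x\<close> is \<open>A x\<^sup>m\<close>.
  Below, \<open>\<le>\<close> on \<open>real ^ 'n\<close> is the componentwise order.
\<close>

definition tensor_apply ::
    "('m::{finite, linorder}, 'n::finite) tensor \<Rightarrow> real ^ 'n \<Rightarrow> real ^ 'n" where
  "tensor_apply A x =
     (\<chi> i. \<Sum>f | f first_pos = i. A $ f * (\<Prod>k\<in>UNIV - {first_pos}. x $ f k))"

definition tensor_form ::
    "('m::{finite, linorder}, 'n::finite) tensor \<Rightarrow> real ^ 'n \<Rightarrow> real" where
  "tensor_form A x = x \<bullet> tensor_apply A x"

definition Sol ::
    "('m::{finite, linorder}, 'n::finite) tensor \<Rightarrow> real ^ 'n \<Rightarrow> (real ^ 'n) set" where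
  "Sol A a = {x. 0 \<le> x \<and> 0 \<le> tensor_apply A x + a \<and> tensor_form A x + x \<bullet> a = 0}"

definition R0_tensor :: "('m::{finite, linorder}, 'n::finite) tensor \<Rightarrow> bool" where
  "R0_tensor A \<longleftrightarrow> Sol A 0 = {0}"

end

theory Submission
  imports Defs
begin

text \<open>
  Scaling a solution of \<open>TCP(A, a)\<close> by \<open>t > 0\<close> gives a solution of \<open>TCP(A, t\<^sup>m\<^sup>-\<^sup>1 a)\<close>, and the
  graph of \<open>Sol\<close> is closed. If \<open>A\<close> is R0, compactness of the unit sphere then keeps \<open>Sol(A + B, c)\<close>
  off the sphere for all \<open>B\<close> and \<open>c\<close> of norm at most some \<open>\<epsilon> > 0\<close>. Normalizing a large solution
  \<open>x\<close> of \<open>TCP(A + B, a + b)\<close> gives a unit solution for \<open>c = (a + b) / \<bar>x\<bar>\<^sup>m\<^sup>-\<^sup>1\<close>, which is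
  therefore not small, and this bounds \<open>\<bar>x\<bar>\<close>. Conversely \<open>Sol(A, 0)\<close> is a cone, so it is \<open>{0}\<close> as
  soon as it is bounded.
\<close>

lemma tensor_apply_scaleR:
  fixes A :: "('m::{finite, linorder}, 'n::finite) tensor"
  shows "tensor_apply A (t *\<^sub>R x) = t ^ (CARD('m) - 1) *\<^sub>R tensor_apply A x"
proof -
  have "card (UNIV - {first_pos :: 'm}) = CARD('m) - 1"
    by (simp add: card_Diff_singleton)
  then show ?thesis
    by (simp add: tensor_apply_def vec_eq_iff prod.distrib sum_distrib_left mult_ac)
qed

text \<open>The three conditions scale by \<open>t\<close>, by \<open>t ^ (CARD('m) - 1)\<close> and
  by the product of both, so a nonnegative \<open>t\<close> preserves each of them.\<close>

lemma Sol_scaleR: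
  fixes A :: "('m::{finite, linorder}, 'n::finite) tensor"
  assumes "x \<in> Sol A a" and "0 \<le> t"
  shows "t *\<^sub>R x \<in> Sol A (t ^ (CARD('m) - 1) *\<^sub>R a)"
proof -
  let ?s = "t ^ (CARD('m) - 1)"
  have x: "0 \<le> x" "0 \<le> tensor_apply A x + a" "tensor_form A x + x \<bullet> a = 0"
    using assms(1) by (auto simp: Sol_def)
  have "0 \<le> t *\<^sub>R x"
    using x(1) assms(2) by (simp add: scaleR_nonneg_nonneg)
  moreover have "0 \<le> tensor_apply A (t *\<^sub>R x) + ?s *\<^sub>R a"
    using scaleR_nonneg_nonneg[OF zero_le_power[OF assms(2)] x(2)]
    by (simp add: tensor_apply_scaleR scaleR_add_right)
  moreover have "tensor_form A (t *\<^sub>R x) + (t *\<^sub>R x) \<bullet> (?s *\<^sub>R a)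
      = t * ?s * (tensor_form A x + x \<bullet> a)"
    by (simp add: tensor_form_def tensor_apply_scaleR algebra_simps)
  ultimately show ?thesis
    using x(3) by (simp add: Sol_def)
qed

text \<open>Homogeneity with factor 0 makes \<open>tensor_apply A 0\<close> vanish, because the
  exponent \<open>CARD('m) - 1\<close> is positive. In order 1 it would be the constant
  \<open>A\<close> instead.\<close>

lemma zero_in_Sol_zero:
  fixes A :: "('m::{finite, linorder}, 'n::finite) tensor"
  assumes "CARD('m) \<ge> 2"
  shows "0 \<in> Sol A 0"
  using tensor_apply_scaleR[of A 0 0] assms
  by (simp add: Sol_def tensor_form_def power_0_left)

lemma R0_tensor_if_bounded_Sol:
  fixes A :: "('m::{finite, linorder}, 'n::finite) tensor"
  assumes "CARD('m) \<ge> 2" and "bounded (Sol A 0)"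
  shows "R0_tensor A"
proof -
  obtain M where M: "\<And>x. x \<in> Sol A 0 \<Longrightarrow> norm x \<le> M"
    using assms(2) unfolding bounded_iff by blast
  have "x = 0" if "x \<in> Sol A 0" for x
  proof (rule ccontr)
    assume "x \<noteq> 0"
    \<comment> \<open>This stretches \<open>x\<close> to norm \<open>\<bar>M\<bar> + 1\<close>,
      beyond the bound \<open>M\<close>; the absolute value keeps \<open>t\<close>
      nonnegative.\<close>
    define t where "t = (\<bar>M\<bar> + 1) / norm x"
    have "t *\<^sub>R x \<in> Sol A 0"
      using Sol_scaleR[OF that, of t] by (simp add: t_def)
    from M[OF this] show False
      using \<open>x \<noteq> 0\<close> by (simp add: t_def)
  qed
  then show ?thesis
    using zero_in_Sol_zero[OF assms(1)] by (auto simp: R0_tensor_def)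
qed

lemma tendsto_tensor_apply:
  assumes "(B \<longlongrightarrow> A) F" and "(y \<longlongrightarrow> x) F"
  shows "((\<lambda>k. tensor_apply (B k) (y k)) \<longlongrightarrow> tensor_apply A x) F"
  unfolding tensor_apply_def
  by (intro tendsto_vec_lambda tendsto_sum tendsto_mult tendsto_prod tendsto_vec_nth assms)

lemma tendsto_nonneg_vec:
  fixes x :: "real ^ 'n"
  assumes "(y \<longlongrightarrow> x) F" and "F \<noteq> bot" and "\<And>k. 0 \<le> y k"
  shows "0 \<le> x"
  unfolding less_eq_vec_def
proof
  fix i
  show "0 $ i \<le> x $ i"
    using assms(3)
    by (intro tendsto_lowerbound[OF tendsto_vec_nth[OF assms(1)] _ assms(2)] always_eventually)
      (simp add: less_eq_vec_def)
qed

text \<open>The conditions defining \<open>Sol\<close> are weak inequalities and an equation between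
  functions jointly continuous in tensor, vector and point, so they pass to the limit.\<close>

lemma Sol_closed_graph:
  assumes "(B \<longlongrightarrow> A) F" and "(b \<longlongrightarrow> a) F" and "(y \<longlongrightarrow> x) F" and "F \<noteq> bot"
    and Sol: "\<And>k. y k \<in> Sol (B k) (b k)"
  shows "x \<in> Sol A a"
proof -
  have "0 \<le> x"
    using tendsto_nonneg_vec[OF assms(3,4)] Sol by (simp add: Sol_def)
  moreover have "0 \<le> tensor_apply A x + a"
    using tendsto_nonneg_vec[OF tendsto_add[OF tendsto_tensor_apply[OF assms(1,3)] assms(2)] assms(4)]
      Sol by (simp add: Sol_def)
  moreover have "((\<lambda>k. tensor_form (B k) (y k) + y k \<bullet> b k) \<longlongrightarrow> tensor_form A x + x \<bullet> a) F"
    unfolding tensor_form_def by (intro tendsto_intros tendsto_tensor_apply assms)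
  then have "((\<lambda>k. 0) \<longlongrightarrow> tensor_form A x + x \<bullet> a) F"
    using Sol by (simp add: Sol_def)
  then have "tensor_form A x + x \<bullet> a = 0"
    using assms(4) by (simp add: tendsto_const_iff)
  ultimately show ?thesis
    by (simp add: Sol_def)
qed

text \<open>Otherwise perturbations of size at most \<open>1 / (k + 1)\<close> admit unit solutions;
  a subsequence of these converges to a unit vector in \<open>Sol A 0\<close>.\<close>

lemma R0_tensor_imp_no_unit_solution_nearby:
  fixes A :: "('m::{finite, linorder}, 'n::finite) tensor"
  assumes "R0_tensor A"
  obtains \<epsilon> where "\<epsilon> > 0"
    and "\<And>B c y. \<lbrakk>norm B \<le> \<epsilon>; norm c \<le> \<epsilon>; norm y = 1\<rbrakk> \<Longrightarrow> y \<notin> Sol (A + B) c"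
proof (rule ccontr)
  assume "\<not> thesis"
  then have "\<forall>\<epsilon>>0. \<exists>B c y. norm B \<le> \<epsilon> \<and> norm c \<le> \<epsilon> \<and> norm y = 1 \<and> y \<in> Sol (A + B) c"
    using that by blast
  then have "\<forall>k. \<exists>B c y. norm B \<le> inverse (real (Suc k)) \<and> norm c \<le> inverse (real (Suc k))
      \<and> norm y = 1 \<and> y \<in> Sol (A + B) c"
    by simp
  then obtain B c y where B: "\<And>k. norm (B k) \<le> inverse (real (Suc k))"
    and c: "\<And>k. norm (c k) \<le> inverse (real (Suc k))"
    and y: "\<And>k. norm (y k) = 1" and Sol: "\<And>k. y k \<in> Sol (A + B k) (c k)"
    by metis
  have "B \<longlonglongrightarrow> 0" and "c \<longlonglongrightarrow> 0"
    using B c by (auto intro: Lim_null_comparison[OF _ LIMSEQ_inverse_real_of_nat])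
  obtain x r where x: "norm x = 1" and r: "strict_mono (r :: nat \<Rightarrow> nat)" and lim: "(y \<circ> r) \<longlonglongrightarrow> x"
    using y compact_sphere[of "0 :: real ^ 'n" 1] unfolding compact_def by (metis mem_sphere_0)
  have "x \<in> Sol (A + 0) 0"
  proof (rule Sol_closed_graph)
    show "(\<lambda>k. A + (B \<circ> r) k) \<longlonglongrightarrow> A + 0"
      by (intro tendsto_add tendsto_const LIMSEQ_subseq_LIMSEQ \<open>B \<longlonglongrightarrow> 0\<close> r)
    show "(c \<circ> r) \<longlonglongrightarrow> 0"
      by (intro LIMSEQ_subseq_LIMSEQ \<open>c \<longlonglongrightarrow> 0\<close> r)
  qed (use lim Sol in auto)
  then show False
    using assms x by (auto simp: R0_tensor_def)
qed

text \<open>The radius \<epsilon> is chosen before \<open>a\<close>, which lets one \<epsilon> serve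
  every \<delta> and every \<open>a\<close> in the theorem.\<close>

lemma R0_tensor_imp_bounded_Sol_nearby:
  fixes A :: "('m::{finite, linorder}, 'n::finite) tensor"
  assumes "CARD('m) \<ge> 2" and "R0_tensor A"
  obtains \<epsilon> where "\<epsilon> > 0"
    and "\<And>B a x. \<lbrakk>norm B \<le> \<epsilon>; x \<in> Sol (A + B) a\<rbrakk> \<Longrightarrow> norm x \<le> max 1 (norm a / \<epsilon>)"
proof -
  obtain \<epsilon> where "\<epsilon> > 0"
    and \<epsilon>: "\<And>B c y. \<lbrakk>norm B \<le> \<epsilon>; norm c \<le> \<epsilon>; norm y = 1\<rbrakk> \<Longrightarrow> y \<notin> Sol (A + B) c"
    using R0_tensor_imp_no_unit_solution_nearby[OF assms(2)] by blast
  have "norm x \<le> max 1 (norm a / \<epsilon>)" if "norm B \<le> \<epsilon>" and x: "x \<in> Sol (A + B) a" for B a x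
  proof (rule ccontr)
    assume "\<not> ?thesis"
    then have x1: "1 < norm x" and "norm a < \<epsilon> * norm x"
      using \<open>\<epsilon> > 0\<close> by (simp_all add: not_le pos_divide_less_eq mult.commute)
    \<comment> \<open>The exponent is at least 1 and \<open>norm x > 1\<close>; this turns a root of
      \<open>norm a / \<epsilon>\<close> into a bound linear in \<open>norm a\<close>.\<close>
    moreover have "norm x \<le> norm x ^ (CARD('m) - 1)"
      using x1 assms(1) power_increasing[of 1 "CARD('m) - 1" "norm x"] by simp
    ultimately have "norm a \<le> \<epsilon> * norm x ^ (CARD('m) - 1)"
      using \<open>\<epsilon> > 0\<close> by (meson mult_left_mono less_imp_le order_trans)
    then have "norm (inverse (norm x) ^ (CARD('m) - 1) *\<^sub>R a) \<le> \<epsilon>"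
      using pos_divide_le_eq[OF zero_less_power[OF less_trans[OF zero_less_one x1]], of "norm a"]
      by (simp add: power_inverse divide_inverse_commute)
    moreover have "norm (inverse (norm x) *\<^sub>R x) = 1"
      using x1 left_inverse[of "norm x"] by (cases "x = 0") auto
    ultimately show False
      using \<epsilon>[OF \<open>norm B \<le> \<epsilon>\<close>] Sol_scaleR[OF x, of "inverse (norm x)"] by simp
  qed
  with \<open>\<epsilon> > 0\<close> show thesis
    using that by blast
qed

theorem theorem3p1:
  fixes A :: "('m::{finite, linorder}, 'n::finite) tensor"
  assumes "CARD('m) \<ge> 2" and "CARD('n) \<ge> 2"
  shows "R0_tensor A \<longleftrightarrow>
    (\<exists>\<epsilon>>0. \<forall>\<delta>>0. \<forall>a :: real ^ 'n.
      bounded (\<Union>(B, b) \<in> cball (0 :: ('m, 'n) tensor) \<epsilon> \<times> cball (0 :: real ^ 'n) \<delta>.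
        Sol (A + B) (a + b)))"
    (is "_ \<longleftrightarrow> (\<exists>\<epsilon>>0. \<forall>\<delta>>0. \<forall>a. bounded (?S \<epsilon> \<delta> a))")
proof
  assume "R0_tensor A"
  then obtain \<epsilon> where "\<epsilon> > 0"
    and \<epsilon>: "\<And>B a x. \<lbrakk>norm B \<le> \<epsilon>; x \<in> Sol (A + B) a\<rbrakk> \<Longrightarrow> norm x \<le> max 1 (norm a / \<epsilon>)"
    using R0_tensor_imp_bounded_Sol_nearby[OF assms(1)] by blast
  have "bounded (?S \<epsilon> \<delta> a)" for \<delta> a
    unfolding bounded_iff
  proof (intro exI ballI)
    fix x assume "x \<in> ?S \<epsilon> \<delta> a"
    then obtain B b where "norm B \<le> \<epsilon>" and b: "norm b \<le> \<delta>" and "x \<in> Sol (A + B) (a + b)"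
      by auto
    then have "norm x \<le> max 1 (norm (a + b) / \<epsilon>)"
      using \<epsilon> by blast
    also have "norm (a + b) / \<epsilon> \<le> (norm a + \<delta>) / \<epsilon>"
      using b \<open>\<epsilon> > 0\<close> norm_triangle_ineq[of a b] by (intro divide_right_mono) auto
    finally show "norm x \<le> max 1 ((norm a + \<delta>) / \<epsilon>)"
      by (simp add: max.mono)
  qed
  with \<open>\<epsilon> > 0\<close> show "\<exists>\<epsilon>>0. \<forall>\<delta>>0. \<forall>a. bounded (?S \<epsilon> \<delta> a)"
    by blast
next
  assume "\<exists>\<epsilon>>0. \<forall>\<delta>>0. \<forall>a. bounded (?S \<epsilon> \<delta> a)"
  \<comment> \<open>The single instance \<open>\<delta> = 1\<close>, \<open>a = 0\<close> suffices:
    its union contains \<open>Sol A 0\<close> as the unperturbed member.\<close>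
  then obtain \<epsilon> where "\<epsilon> > 0" and bdd: "bounded (?S \<epsilon> 1 0)"
    using zero_less_one by blast
  have "Sol A 0 \<subseteq> ?S \<epsilon> 1 0"
  proof
    fix x assume "x \<in> Sol A 0"
    then show "x \<in> ?S \<epsilon> 1 0"
      using \<open>\<epsilon> > 0\<close> by (intro UN_I[of "(0, 0)"]) auto
  qed
  with bdd have "bounded (Sol A 0)"
    by (rule bounded_subset)
  then show "R0_tensor A"
    by (rule R0_tensor_if_bounded_Sol[OF assms(1)])
qed

end
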